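(* Let $N=(n_{ij})\in\mathrm{SL}(2,\mathbb{Z})$ with $\theta:=\mathrm{Tr}(N)\ge3$. Suppose that $\gcd(n_{12},n_{21},n_{22}-n_{11})=1$. Then: (1) $Z^+_{\mathrm{SL}(2,\mathbb{Z})}(N)=\{N^k\mid k\in\mathbb{Z}\}$, so $Z^+_{\mathrm{SL}(2,\mathbb{Z})}(N)$ is the cyclic subgroup of $\mathrm{SL}(2,\mathbb{Z})$ generated by $N$. (2) If $\theta>3$, then $Z^+_{\mathrm{GL}(2,\mathbb{Z})}(N)=Z^+_{\mathrm{SL}(2,\mathbb{Z})}(N)$. (3) If $\theta=3$, then $Z^+_{\mathrm{GL}(2,\mathbb{Z})}(N)$ is generated by a matrix $N'\in\mathrm{GL}(2,\mathbb{Z})$ with $N'^2=N$ and $\det(N')=-1$.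
   Context: Let $\alpha=\frac{\theta+\sqrt{\theta^2-4}}{2}>1$ be the larger eigenvalue of $N$ and $a\in\mathbb{R}^2\setminus\{0\}$ an eigenvector of $N$ for $\alpha$. For $G=\mathrm{SL}(2,\mathbb{Z})$ or $G=\mathrm{GL}(2,\mathbb{Z})$, $Z^+_G(N)=\{K\in G\mid KN=NK,\ Ka\in\mathbb{R}^*_+a\}$ (this does not depend on the choice of $a$). *)

theory Defs
  imports "HOL-Analysis.Analysis" "HOL-Algebra.Algebra"
begin

(* In the index type 2 of int^2^2 the numeral 2 denotes the same element as 0; hence the two
   indices are 1 and 2, they are distinct, and M$i$j is the usual matrix entry. *)

definition GL2Z :: "(int^2^2) monoid" where
  "GL2Z = \<lparr>carrier = {K. invertible K}, mult = (**), one = mat 1\<rparr>"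

definition SL2Z :: "(int^2^2) monoid" where
  "SL2Z = \<lparr>carrier = {K. det K = 1}, mult = (**), one = mat 1\<rparr>"

definition real_mat :: "int^2^2 \<Rightarrow> real^2^2" where
  "real_mat K = map_matrix real_of_int K"

text \<open>For an integer matrix of determinant 1 and trace at least 3 this is the larger root of
  the characteristic polynomial.\<close>
definition larger_eigenvalue :: "int^2^2 \<Rightarrow> real" where
  "larger_eigenvalue N = (real_of_int (trace N) + sqrt ((real_of_int (trace N))\<^sup>2 - 4)) / 2"

definition eigenvector :: "int^2^2 \<Rightarrow> real \<Rightarrow> real^2 \<Rightarrow> bool" where
  "eigenvector N c a \<longleftrightarrow> a \<noteq> 0 \<and> real_mat N *v a = c *\<^sub>R a"

text \<open>The eigenvector \<open>a\<close> is a parameter; results are stated for every eigenvector of \<open>N\<close> for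
  \<open>larger_eigenvalue N\<close>.\<close>
definition Zplus :: "(int^2^2) monoid \<Rightarrow> int^2^2 \<Rightarrow> real^2 \<Rightarrow> (int^2^2) set" where
  "Zplus G N a =
    {K \<in> carrier G. K ** N = N ** K \<and> (\<exists>r>0. real_mat K *v a = r *\<^sub>R a)}"

lemma det_adj_right:
  fixes K :: "int^2^2"
  assumes "det K * d = 1"
  shows "K ** (\<chi> i j. if i = j then d * K $ (if i = 1 then 2 else 1) $ (if i = 1 then 2 else 1)
                     else - d * K $ i $ j) = mat 1"
  using assms
  by (auto simp: vec_eq_iff forall_2 matrix_matrix_mult_def sum_2 det_2 mat_def algebra_simps)

lemma det_adj_left:
  fixes K :: "int^2^2"
  assumes "det K * d = 1"
  shows "(\<chi> i j. if i = j then d * K $ (if i = 1 then 2 else 1) $ (if i = 1 then 2 else 1)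
                     else - d * K $ i $ j) ** K = mat 1"
  using assms
  by (auto simp: vec_eq_iff forall_2 matrix_matrix_mult_def sum_2 det_2 mat_def algebra_simps)

lemma invertible_int_iff_det:
  fixes K :: "int^2^2"
  shows "invertible K \<longleftrightarrow> det K = 1 \<or> det K = -1"
proof
  assume "invertible K"
  then obtain B where "K ** B = mat 1" unfolding invertible_def by blast
  then have "det K * det B = 1" by (metis det_I det_mul)
  then show "det K = 1 \<or> det K = -1" using zmult_eq_1_iff by blast
next
  assume "det K = 1 \<or> det K = -1"
  then have "det K * det K = 1" by auto
  then show "invertible K"
    unfolding invertible_def using det_adj_left det_adj_right by blast
qed

lemma group_GL2Z: "group GL2Z"
proof (rule groupI)
  fix K assume "K \<in> carrier GL2Z"
  then show "\<exists>B\<in>carrier GL2Z. B \<otimes>\<^bsub>GL2Z\<^esub> K = \<one>\<^bsub>GL2Z\<^esub>"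
    unfolding GL2Z_def by (auto simp: invertible_def)
qed (auto simp: GL2Z_def invertible_int_iff_det det_mul det_I matrix_mul_assoc)

lemma group_SL2Z: "group SL2Z"
proof (rule groupI)
  fix K assume K: "K \<in> carrier SL2Z"
  then obtain B where B: "B ** K = mat 1"
    unfolding SL2Z_def using det_adj_left[of K 1] by auto
  then have "det B * det K = 1" by (metis det_I det_mul)
  with K B show "\<exists>B\<in>carrier SL2Z. B \<otimes>\<^bsub>SL2Z\<^esub> K = \<one>\<^bsub>SL2Z\<^esub>"
    unfolding SL2Z_def by auto
qed (auto simp: SL2Z_def det_mul det_I matrix_mul_assoc)

end

theory Submission
  imports Defs
begin

text \<open>A matrix commuting with \<open>N\<close> has the form \<open>x I + y N\<close>, with integers \<open>x\<close>, \<open>y\<close> by the gcd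
  hypothesis. Its eigenvalue on \<open>a\<close> is \<open>r = x + y \<alpha>\<close> and its determinant is the norm
  \<open>(x + y \<alpha>) (x + y / \<alpha>)\<close>. Multiplication by a power of \<open>N\<close> moves a positive \<open>r\<close> into the
  interval \<open>[1, \<alpha>)\<close>. If the norm is 1, then \<open>y (\<alpha> - 1 / \<alpha>) = r - 1 / r\<close> is less than
  \<open>\<alpha> - 1 / \<alpha>\<close>, so \<open>y = 0\<close> and the matrix is the identity. If the norm is -1, then
  \<open>y (\<alpha> - 1 / \<alpha>) = r + 1 / r \<le> \<theta>\<close> forces \<open>y = 1\<close> and \<open>x (x + \<theta>) = -2\<close>, so \<open>\<theta> = 3\<close>; in that
  case \<open>N - I\<close> is the required square root of \<open>N\<close>.\<close>

section \<open>Elements of norm 1 and -1 with value between 1 and \<alpha>\<close>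

lemma unit_in_fundamental_interval:
  fixes \<theta> x y :: int and \<alpha> :: real
  assumes \<theta>: "\<theta> \<ge> 3" and \<alpha>: "\<alpha> > 1" "\<alpha> + 1 / \<alpha> = \<theta>"
    and norm: "x\<^sup>2 + \<theta> * x * y + y\<^sup>2 = d" "d = 1 \<or> d = -1"
    and r: "1 \<le> x + y * \<alpha>" "x + y * \<alpha> < \<alpha>"
  shows "d = 1 \<and> x = 1 \<and> y = 0 \<or> d = -1 \<and> \<theta> = 3"
proof -
  \<comment> \<open>The second root of X^2 - \<theta> X + 1 is \<beta>, so \<open>s\<close> is the
    conjugate of \<open>r\<close> and \<open>r * s\<close> is the norm.\<close>
  define r s \<beta> where "r = x + y * \<alpha>" and "s = x + y * (1 / \<alpha>)" and "\<beta> = 1 / \<alpha>"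
  have \<beta>: "\<beta> < 1" "\<alpha> * \<beta> = 1" "\<alpha> + \<beta> = \<theta>"
    using \<alpha> by (auto simp: \<beta>_def)
  have "r * s = x\<^sup>2 + (\<alpha> + \<beta>) * x * y + (\<alpha> * \<beta>) * y\<^sup>2"
    by (simp add: r_def s_def \<beta>_def algebra_simps power2_eq_square)
  also have "\<dots> = of_int (x\<^sup>2 + \<theta> * x * y + y\<^sup>2)"
    by (simp add: \<beta>)
  finally have rs: "r * s = d" using norm by simp
  have r1: "1 \<le> r" "r < \<alpha>" using r by (auto simp: r_def)
  have s: "s = d / r" using rs r1 by (simp add: field_simps)
  \<comment> \<open>Subtracting the conjugate removes \<open>x\<close>, so bounds on
    \<open>r\<close> and \<open>s\<close> bound \<open>y\<close> alone.\<close>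
  have diff: "y * (\<alpha> - \<beta>) = r - s" by (simp add: r_def s_def \<beta>_def algebra_simps)
  have pos: "\<alpha> - \<beta> > 0" using \<alpha> \<beta> by simp
  show ?thesis
  proof (cases "d = 1")
    case True
    then have s': "s = 1 / r" using s by simp
    have "s \<le> 1" using r1 s' by simp
    then have "0 \<le> y * (\<alpha> - \<beta>)" using diff r1 by simp
    then have y0: "0 \<le> y" using pos by (simp add: zero_le_mult_iff)
    have "\<beta> < s" using r1 s' unfolding \<beta>_def by (simp add: frac_less2)
    then have "y * (\<alpha> - \<beta>) < 1 * (\<alpha> - \<beta>)" using diff r1 by simp
    then have "y < 1" using pos mult_less_cancel_right_pos by fastforce
    then have y: "y = 0" using y0 by simp
    then have "x\<^sup>2 = 1" using norm True by simp
    moreover have "x \<ge> 1" using r y by simp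
    ultimately show ?thesis using True y by (simp add: power2_eq_1_iff)
  next
    case False
    then have d: "d = -1" using norm by simp
    then have s': "s = - (1 / r)" using s by simp
    have "y * (\<alpha> - \<beta>) > 0" using diff r1 s' by (smt (verit) divide_pos_pos)
    then have y1: "y \<ge> 1" using pos by (simp add: zero_less_mult_iff)
    \<comment> \<open>X^2 - \<theta> X + 1 = (X - \<alpha>)(X - \<beta>) is nonpositive between its
      roots, and \<open>r\<close> lies there.\<close>
    have "(\<alpha> - r) * (r - \<beta>) \<ge> 0" using r1 \<beta> by simp
    then have "r * r + 1 \<le> r * \<theta>" using \<beta> by (simp add: algebra_simps flip: \<beta>(3))
    then have "r + 1 / r \<le> \<theta>" using r1 by (simp add: field_simps)
    then have le: "y * (\<alpha> - \<beta>) \<le> \<theta>" using diff s' by simp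
    \<comment> \<open>Since (\<alpha> - \<beta>)^2 = \<theta>^2 - 4, \<open>y\<close> at least 2
      would give 4 (\<theta>^2 - 4) \<le> \<theta>^2, which fails for \<theta> \<ge> 3.\<close>
    have "y < 2"
    proof (rule ccontr)
      assume "\<not> y < 2"
      then have "2 * (\<alpha> - \<beta>) \<le> y * (\<alpha> - \<beta>)" using pos by (intro mult_right_mono) auto
      then have "2 * (\<alpha> - \<beta>) \<le> \<theta>" using le by simp
      then have "(2 * (\<alpha> - \<beta>))\<^sup>2 \<le> (real_of_int \<theta>)\<^sup>2" using pos by (intro power_mono) auto
      moreover have "(2 * (\<alpha> - \<beta>))\<^sup>2 = 4 * (\<alpha> + \<beta>)\<^sup>2 - 16 * (\<alpha> * \<beta>)"
        by (simp add: power2_eq_square algebra_simps)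
      ultimately have "3 * (real_of_int \<theta>)\<^sup>2 \<le> 16" by (simp add: \<beta>)
      moreover have "(3::real)\<^sup>2 \<le> (real_of_int \<theta>)\<^sup>2" using \<theta> by (intro power_mono) auto
      ultimately show False by simp
    qed
    then have "y = 1" using y1 by simp
    then have eq: "x * (x + \<theta>) = -2" using norm d by (simp add: power2_eq_square algebra_simps)
    then have "x < 0" using \<theta> by (smt (verit) mult_nonneg_nonneg)
    moreover have "x dvd 2" using eq by (metis dvd_minus_iff dvd_triv_left)
    \<comment> \<open>The cofactor x + \<theta> is 2 or 1 respectively; both cases give \<theta> =
      3.\<close>
    ultimately have "x = -1 \<or> x = -2" using zdvd_imp_le[of "-x" 2] by auto
    then show ?thesis using eq d by auto
  qed
qed

section \<open>Integer matrices commuting with \<open>N\<close>\<close>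

text \<open>Commutation makes the triple (12 entry, 21 entry, difference of diagonal entries) of
  \<open>K\<close> proportional to that of \<open>N\<close>. As the latter triple is primitive, the
  factor is an integer.\<close>

lemma commuting_integer_matrix:
  fixes K N :: "int^2^2"
  assumes "K ** N = N ** K"
    and "gcd (gcd (N$1$2) (N$2$1)) (N$2$2 - N$1$1) = 1"
  obtains x y where "K = (\<chi> i j. (if i = j then x else 0) + y * N$i$j)"
proof -
  define p q t where "p = N$1$2" and "q = N$2$1" and "t = N$2$2 - N$1$1"
  define p' q' t' where "p' = K$1$2" and "q' = K$2$1" and "t' = K$2$2 - K$1$1"
  obtain u v where uv: "u * p + v * q = gcd p q" using bezout_int by blast
  obtain w z where "w * gcd p q + z * t = gcd (gcd p q) t" using bezout_int by blast
  then have "w * (u * p + v * q) + z * t = 1"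
    using assms(2) by (simp add: p_def q_def t_def uv[unfolded p_def q_def])
  then have bez: "w * u * p + w * v * q + z * t = 1" by (simp add: algebra_simps)
  have c: "(K ** N)$i$j = (N ** K)$i$j" for i j using assms(1) by simp
  \<comment> \<open>Three entries of the commutation identity are the vanishing 2x2 minors of the
    two triples.\<close>
  have pq: "p * q' = q * p'"
    using c[of 1 1] by (simp add: matrix_matrix_mult_def sum_2 p_def q_def p'_def q'_def mult.commute)
  have pt: "p * t' = t * p'"
    using c[of 1 2] by (simp add: matrix_matrix_mult_def sum_2 p_def t_def p'_def t'_def right_diff_distrib
        left_diff_distrib mult.commute)
  have qt: "q * t' = t * q'"
    using c[of 2 1] by (simp add: matrix_matrix_mult_def sum_2 q_def t_def q'_def t'_def right_diff_distrib
        left_diff_distrib mult.commute)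
  \<comment> \<open>A factor \<open>y\<close> between the triples must be the value on the triple of
    \<open>K\<close> of the Bezout combination that is 1 on the triple of \<open>N\<close>.\<close>
  define y where "y = w * u * p' + w * v * q' + z * t'"
  have "p' - y * p = (1 - (w * u * p + w * v * q + z * t)) * p'
      + w * v * (q * p' - p * q') + z * (t * p' - p * t')"
    by (simp add: y_def algebra_simps)
  then have p': "p' = y * p" by (simp add: bez pq pt)
  have "q' - y * q = (1 - (w * u * p + w * v * q + z * t)) * q'
      + w * u * (p * q' - q * p') + z * (t * q' - q * t')"
    by (simp add: y_def algebra_simps)
  then have q': "q' = y * q" by (simp add: bez pq qt)
  have "t' - y * t = (1 - (w * u * p + w * v * q + z * t)) * t'
      + w * u * (p * t' - t * p') + w * v * (q * t' - t * q')"
    by (simp add: y_def algebra_simps)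
  then have t': "t' = y * t" by (simp add: bez pt qt)
  have "K = (\<chi> i j. (if i = j then K$1$1 - y * N$1$1 else 0) + y * N$i$j)"
    using p' q' t' by (simp add: vec_eq_iff forall_2 p_def q_def t_def p'_def q'_def t'_def
        algebra_simps)
  then show ?thesis using that by blast
qed

section \<open>Eigenvalues on \<open>a\<close> and the group structure\<close>

lemma real_mat_mult: "real_mat (K ** L) = real_mat K ** real_mat L"
  by (simp add: real_mat_def map_matrix_def matrix_matrix_mult_def vec_eq_iff)

lemma real_mat_one: "real_mat (mat 1) = mat 1"
  by (simp add: real_mat_def map_matrix_def mat_def vec_eq_iff)

lemma real_mat_vector_mult:
  "real_mat (K ** L) *v a = real_mat K *v (real_mat L *v a)"
  by (simp add: real_mat_mult matrix_vector_mul_assoc)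

text \<open>This form lets integer powers in \<open>SL2Z\<close> be identified with those in
  \<open>GL2Z\<close>.\<close>

lemma SL2Z_eq: "SL2Z = GL2Z\<lparr>carrier := {K. det K = 1}\<rparr>"
  by (simp add: SL2Z_def GL2Z_def)

lemma GL2Z_inv:
  assumes "K \<in> carrier GL2Z"
  shows "inv\<^bsub>GL2Z\<^esub> K \<in> carrier GL2Z" "K ** inv\<^bsub>GL2Z\<^esub> K = mat 1" "inv\<^bsub>GL2Z\<^esub> K ** K = mat 1"
  using group.r_inv[OF group_GL2Z assms] group.l_inv[OF group_GL2Z assms]
    group.inv_closed[OF group_GL2Z assms] by (simp_all add: GL2Z_def)

lemma subgroup_SL2Z: "subgroup {K. det K = 1} GL2Z"
proof (rule group.subgroupI[OF group_GL2Z])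
  show "{K. det K = 1} \<subseteq> carrier GL2Z"
    by (auto simp: GL2Z_def invertible_int_iff_det)
  then show "inv\<^bsub>GL2Z\<^esub> K \<in> {K. det K = 1}" if "K \<in> {K. det K = 1}" for K
    using GL2Z_inv(2)[of K] that det_mul[of K "inv\<^bsub>GL2Z\<^esub> K"] by auto
  show "{K. det K = (1::int)} \<noteq> {}" using det_I by blast
qed (auto simp: GL2Z_def det_mul)

lemma eigenvalue_inv:
  assumes K: "K \<in> carrier GL2Z" and r: "real_mat K *v a = r *\<^sub>R a" "r \<noteq> 0"
  shows "real_mat (inv\<^bsub>GL2Z\<^esub> K) *v a = inverse r *\<^sub>R a"
proof -
  have "a = r *\<^sub>R (real_mat (inv\<^bsub>GL2Z\<^esub> K) *v a)"
    using real_mat_vector_mult[of "inv\<^bsub>GL2Z\<^esub> K" K a]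
    by (simp add: GL2Z_inv K real_mat_one r matrix_vector_mult_scaleR)
  then have "inverse r *\<^sub>R a = inverse r *\<^sub>R r *\<^sub>R (real_mat (inv\<^bsub>GL2Z\<^esub> K) *v a)" by simp
  then show ?thesis using r(2) by simp
qed

lemma eigenvalue_int_pow:
  fixes k :: int
  assumes K: "K \<in> carrier GL2Z" and r: "real_mat K *v a = r *\<^sub>R a" "r \<noteq> 0"
  shows "real_mat (K [^]\<^bsub>GL2Z\<^esub> k) *v a = (r powi k) *\<^sub>R a"
proof -
  interpret group GL2Z by (rule group_GL2Z)
  have nat: "real_mat (K [^]\<^bsub>GL2Z\<^esub> n) *v a = (r ^ n) *\<^sub>R a" for n :: nat
  proof (induction n)
    case 0
    show ?case by (simp add: GL2Z_def real_mat_one)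
  next
    case (Suc n)
    have "real_mat (K [^]\<^bsub>GL2Z\<^esub> Suc n) *v a = real_mat (K [^]\<^bsub>GL2Z\<^esub> n) *v (real_mat K *v a)"
      by (simp add: GL2Z_def real_mat_vector_mult)
    then show ?case by (simp add: r matrix_vector_mult_scaleR Suc)
  qed
  show ?thesis
  proof (cases k rule: int_cases2)
    case (nonneg n)
    then show ?thesis by (simp add: int_pow_int nat)
  next
    case (nonpos n)
    then show ?thesis
      using eigenvalue_inv[OF nat_pow_closed[OF K] nat] r(2) K
      by (simp add: int_pow_neg int_pow_int power_int_minus)
  qed
qed

lemma subgroup_Zplus_GL2Z: "subgroup (Zplus GL2Z N a) GL2Z"
proof (rule group.subgroupI[OF group_GL2Z])
  show "Zplus GL2Z N a \<subseteq> carrier GL2Z" by (auto simp: Zplus_def)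
  have "mat 1 \<in> Zplus GL2Z N a"
    using group.is_monoid[OF group_GL2Z, THEN monoid.one_closed]
    by (auto simp: Zplus_def GL2Z_def real_mat_one intro!: exI[of _ 1])
  then show "Zplus GL2Z N a \<noteq> {}" by blast
next
  fix K assume K: "K \<in> Zplus GL2Z N a"
  let ?L = "inv\<^bsub>GL2Z\<^esub> K"
  from K obtain r where Kc: "K \<in> carrier GL2Z" and KN: "K ** N = N ** K"
    and r: "r > 0" "real_mat K *v a = r *\<^sub>R a" by (auto simp: Zplus_def)
  note L = GL2Z_inv[OF Kc]
  \<comment> \<open>The identity \<open>K ** ?L = mat 1\<close> is inserted on the right, so that
    \<open>N ** K\<close> can be swapped.\<close>
  have "?L ** N = ?L ** (N ** K) ** ?L"
    by (simp add: L flip: matrix_mul_assoc)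
  also have "\<dots> = ?L ** K ** N ** ?L" by (simp add: matrix_mul_assoc flip: KN)
  also have "\<dots> = N ** ?L" by (simp add: L)
  finally have "?L ** N = N ** ?L" .
  moreover have "real_mat ?L *v a = inverse r *\<^sub>R a"
    using eigenvalue_inv[OF Kc r(2)] r(1) by simp
  ultimately show "?L \<in> Zplus GL2Z N a"
    using L r(1) unfolding Zplus_def by (auto intro!: exI[of _ "inverse r"])
next
  fix K L assume "K \<in> Zplus GL2Z N a" "L \<in> Zplus GL2Z N a"
  then obtain r s where K: "K \<in> carrier GL2Z" "K ** N = N ** K" "r > 0" "real_mat K *v a = r *\<^sub>R a"
    and L: "L \<in> carrier GL2Z" "L ** N = N ** L" "s > 0" "real_mat L *v a = s *\<^sub>R a"
    by (auto simp: Zplus_def)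
  have "K \<otimes>\<^bsub>GL2Z\<^esub> L \<in> carrier GL2Z"
    by (rule monoid.m_closed[OF group.is_monoid[OF group_GL2Z] K(1) L(1)])
  moreover have "K ** L ** N = N ** (K ** L)"
    using K(2) L(2) by (metis matrix_mul_assoc)
  moreover have "real_mat (K ** L) *v a = (s * r) *\<^sub>R a"
    by (simp add: real_mat_vector_mult K L matrix_vector_mult_scaleR)
  ultimately show "K \<otimes>\<^bsub>GL2Z\<^esub> L \<in> Zplus GL2Z N a"
    using K(3) L(3) by (auto simp: Zplus_def GL2Z_def intro!: exI[of _ "s * r"])
qed

lemma Zplus_SL2Z: "Zplus SL2Z N a = Zplus GL2Z N a \<inter> {K. det K = 1}"
  by (auto simp: Zplus_def SL2Z_def GL2Z_def invertible_int_iff_det)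

section \<open>Reduction modulo powers of \<open>N\<close>\<close>

lemma larger_eigenvalue:
  assumes "trace N \<ge> 3"
  shows "larger_eigenvalue N > 1"
    and "larger_eigenvalue N + 1 / larger_eigenvalue N = trace N"
proof -
  define t where "t = real_of_int (trace N)"
  define d where "d = sqrt (t\<^sup>2 - 4)"
  have t: "t \<ge> 3" using assms by (simp add: t_def)
  then have "t\<^sup>2 \<ge> 3\<^sup>2" by (intro power_mono) auto
  then have d: "d \<ge> 0" "d\<^sup>2 = t\<^sup>2 - 4" by (simp_all add: d_def)
  have \<alpha>: "larger_eigenvalue N = (t + d) / 2"
    by (simp add: larger_eigenvalue_def t_def d_def)
  show gt: "larger_eigenvalue N > 1" using t d(1) \<alpha> by simp
  \<comment> \<open>These are the two roots of X^2 - t X + 1.\<close>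
  have "(t + d) / 2 * ((t - d) / 2) = 1"
    using d(2) by (simp add: power2_eq_square algebra_simps)
  then have "1 / larger_eigenvalue N = (t - d) / 2"
    using gt unfolding \<alpha> by (simp add: field_simps)
  then show "larger_eigenvalue N + 1 / larger_eigenvalue N = trace N"
    by (simp add: \<alpha> t_def field_simps)
qed

text \<open>Multiplying by a power of \<open>N\<close> preserves the determinant, so both signs are
  treated by one reduction.\<close>

lemma Zplus_GL2Z_cases:
  fixes N :: "int^2^2" and a :: "real^2"
  assumes N: "det N = 1" "trace N \<ge> 3"
    and gcd: "gcd (gcd (N$1$2) (N$2$1)) (N$2$2 - N$1$1) = 1"
    and a: "eigenvector N (larger_eigenvalue N) a"
    and K: "K \<in> Zplus GL2Z N a"
  shows "(det K = 1 \<and> (\<exists>k :: int. K = N [^]\<^bsub>GL2Z\<^esub> k)) \<or> (det K = -1 \<and> trace N = 3)"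
proof -
  interpret group GL2Z by (rule group_GL2Z)
  define \<alpha> where "\<alpha> = larger_eigenvalue N"
  note \<alpha> = larger_eigenvalue[OF N(2), folded \<alpha>_def]
  have a: "a \<noteq> 0" "real_mat N *v a = \<alpha> *\<^sub>R a"
    using a by (auto simp: eigenvector_def \<alpha>_def)
  have Nc: "N \<in> carrier GL2Z" using N by (simp add: GL2Z_def invertible_int_iff_det)
  have NZ: "N \<in> Zplus GL2Z N a"
    using Nc a \<alpha> by (auto simp: Zplus_def intro!: exI[of _ \<alpha>])
  obtain r where r: "r > 0" "real_mat K *v a = r *\<^sub>R a" and Kc: "K \<in> carrier GL2Z"
    using K by (auto simp: Zplus_def)
  \<comment> \<open>This \<open>k\<close> satisfies \<alpha>^k \<le> r < \<alpha>^(k+1), so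
    \<open>L\<close> has its eigenvalue \<open>s\<close> in the interval from 1 (included) to
    \<alpha> (excluded).\<close>
  define k where "k = \<lfloor>log \<alpha> r\<rfloor>"
  define L where "L = K \<otimes>\<^bsub>GL2Z\<^esub> N [^]\<^bsub>GL2Z\<^esub> (- k)"
  define s where "s = \<alpha> powi (- k) * r"
  have LZ: "L \<in> Zplus GL2Z N a"
    unfolding L_def using K NZ subgroup_Zplus_GL2Z
    by (intro subgroup.m_closed subgroup_int_pow_closed) auto
  have "det (N [^]\<^bsub>GL2Z\<^esub> (- k)) = 1"
    using subgroup_int_pow_closed[OF subgroup_SL2Z, of N "- k"] N by simp
  then have detL: "det L = det K" by (simp add: L_def GL2Z_def det_mul)
  have Ls: "real_mat L *v a = s *\<^sub>R a"
    using eigenvalue_int_pow[OF Nc a(2), of "-k"] r \<alpha>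
    by (simp add: L_def s_def GL2Z_def real_mat_vector_mult matrix_vector_mult_scaleR)
  have K_eq: "K = L \<otimes>\<^bsub>GL2Z\<^esub> N [^]\<^bsub>GL2Z\<^esub> k"
    using Nc Kc by (simp add: L_def m_assoc int_pow_neg)
  have "\<alpha> powr k \<le> r" "r < \<alpha> powr (k + 1)"
    using \<alpha> r(1) by (simp_all add: k_def powr_le_iff less_powr_iff)
  then have s: "1 \<le> s" "s < \<alpha>"
    using \<alpha> r(1) by (simp_all add: s_def power_int_minus powr_real_of_int' powr_add field_simps)
  obtain x y where xy: "L = (\<chi> i j. (if i = j then x else 0) + y * N$i$j)"
    using commuting_integer_matrix[OF _ gcd] LZ by (auto simp: Zplus_def)
  have "real_mat L *v a = of_int x *\<^sub>R a + of_int y *\<^sub>R (real_mat N *v a)"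
    by (simp add: xy real_mat_def matrix_vector_mult_def vec_eq_iff forall_2 sum_2 algebra_simps)
  then have "s *\<^sub>R a = (x + y * \<alpha>) *\<^sub>R a" using Ls a by (simp add: algebra_simps)
  then have s_eq: "s = x + y * \<alpha>" using a by simp
  \<comment> \<open>The determinant of x I + y N is the norm form of the arithmetic lemma.\<close>
  have "det L = x\<^sup>2 + trace N * x * y + det N * y\<^sup>2"
    by (simp add: xy det_2 trace_def sum_2 power2_eq_square algebra_simps)
  then have det: "x\<^sup>2 + trace N * x * y + y\<^sup>2 = det K" using detL N by simp
  have "det K = 1 \<or> det K = -1" using Kc by (simp add: GL2Z_def invertible_int_iff_det)
  with unit_in_fundamental_interval[OF N(2) \<alpha> det] s s_eq
  consider "det K = 1" "x = 1" "y = 0" | "det K = -1" "trace N = 3" by fastforce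
  then show ?thesis
  proof cases
    case 1
    then have "L = \<one>\<^bsub>GL2Z\<^esub>" by (simp add: xy GL2Z_def mat_def vec_eq_iff)
    then have "K = N [^]\<^bsub>GL2Z\<^esub> k" using K_eq Nc by simp
    then show ?thesis using 1 by blast
  qed simp
qed

theorem theorem5p4:
  fixes N :: "int^2^2" and a :: "real^2" and \<theta> :: int
  assumes "N \<in> carrier SL2Z"
    and "\<theta> = trace N"
    and "\<theta> \<ge> 3"
    and "gcd (gcd (N$1$2) (N$2$1)) (N$2$2 - N$1$1) = 1"
    and "eigenvector N (larger_eigenvalue N) a"
  shows "(Zplus SL2Z N a = {N [^]\<^bsub>SL2Z\<^esub> k | k :: int. True}
          \<and> subgroup (Zplus SL2Z N a) SL2Z
          \<and> Zplus SL2Z N a = generate SL2Z {N})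
       \<and> (\<theta> > 3 \<longrightarrow> Zplus GL2Z N a = Zplus SL2Z N a)
       \<and> (\<theta> = 3 \<longrightarrow> (\<exists>N' \<in> carrier GL2Z. N' ** N' = N \<and> det N' = -1
              \<and> Zplus GL2Z N a = generate GL2Z {N'}))"
proof -
  interpret group GL2Z by (rule group_GL2Z)
  interpret SL: group SL2Z by (rule group_SL2Z)
  define \<alpha> where "\<alpha> = larger_eigenvalue N"
  have detN: "det N = 1" using assms(1) by (simp add: SL2Z_def)
  have tr: "trace N \<ge> 3" using assms by simp
  note \<alpha> = larger_eigenvalue[OF tr, folded \<alpha>_def]
  have a: "a \<noteq> 0" "real_mat N *v a = \<alpha> *\<^sub>R a"
    using assms(5) by (auto simp: eigenvector_def \<alpha>_def)
  note cases = Zplus_GL2Z_cases[OF detN tr assms(4,5)]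
  have NZ: "N \<in> Zplus GL2Z N a"
    using detN a \<alpha> by (auto simp: Zplus_def GL2Z_def invertible_int_iff_det intro!: exI[of _ \<alpha>])
  have pow: "N [^]\<^bsub>SL2Z\<^esub> k = N [^]\<^bsub>GL2Z\<^esub> k" for k :: int
    using int_pow_consistent[OF subgroup_SL2Z, of N k] detN by (simp add: SL2Z_eq)
  have "N [^]\<^bsub>GL2Z\<^esub> k \<in> Zplus SL2Z N a" for k :: int
    using subgroup_int_pow_closed[OF subgroup_Zplus_GL2Z NZ, of k]
      subgroup_int_pow_closed[OF subgroup_SL2Z, of N k] detN by (simp add: Zplus_SL2Z)
  moreover have "\<exists>k :: int. K = N [^]\<^bsub>GL2Z\<^esub> k" if "K \<in> Zplus SL2Z N a" for K
    using cases[of K] that by (simp add: Zplus_SL2Z)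
  ultimately have powers: "Zplus SL2Z N a = {N [^]\<^bsub>SL2Z\<^esub> k | k :: int. True}"
    unfolding pow by blast
  then have gen: "Zplus SL2Z N a = generate SL2Z {N}"
    using SL.generate_pow[OF assms(1)] by simp
  then have sub: "subgroup (Zplus SL2Z N a) SL2Z"
    using SL.generate_is_subgroup[of "{N}"] assms(1) by simp
  have part2: "Zplus GL2Z N a = Zplus SL2Z N a" if "\<theta> > 3"
    using cases that assms(2) by (auto simp: Zplus_SL2Z)
  have part3: "\<exists>N' \<in> carrier GL2Z. N' ** N' = N \<and> det N' = -1
      \<and> Zplus GL2Z N a = generate GL2Z {N'}" if \<theta>: "\<theta> = 3"
  proof -
    \<comment> \<open>For \<theta> = 3 and y = 1 the norm equation leaves N - I and N - 2 I, which
      are inverse to each other; N - I has the eigenvalue \<alpha> - 1 > 1.\<close>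
    define N' where "N' = N - mat 1"
    have trN: "N$1$1 + N$2$2 = 3" using assms(2) \<theta> by (simp add: trace_def sum_2)
    have dN: "N$1$1 * N$2$2 - N$1$2 * N$2$1 = 1" using detN by (simp add: det_2)
    \<comment> \<open>The characteristic polynomial of \<open>N\<close> at 1 is 1 - 3 + 1.\<close>
    have det': "det N' = -1"
      using trN dN by (simp add: N'_def det_2 mat_def algebra_simps)
    \<comment> \<open>By Cayley-Hamilton \<open>N\<^sup>2 = 3 N - I\<close>, hence \<open>(N - I)\<^sup>2 = N\<close>.\<close>
    have sq: "N' ** N' = N"
    proof -
      have e1: "N$2$2 = 3 - N$1$1" using trN by simp
      have e2: "N$1$2 * N$2$1 = N$1$1 * (3 - N$1$1) - 1" using dN unfolding e1 by simp
      show ?thesis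
        by (simp add: e1 e2 N'_def vec_eq_iff forall_2 matrix_matrix_mult_def sum_2 mat_def algebra_simps)
    qed
    have N'c: "N' \<in> carrier GL2Z" using det' by (simp add: GL2Z_def invertible_int_iff_det)
    have "real_mat N' *v a = real_mat N *v a - a"
      by (simp add: N'_def real_mat_def mat_def matrix_vector_mult_def vec_eq_iff forall_2 sum_2
          algebra_simps)
    then have "real_mat N' *v a = (\<alpha> - 1) *\<^sub>R a" using a by (simp add: algebra_simps)
    moreover have "N' ** N = N ** N'" using sq by (metis matrix_mul_assoc)
    ultimately have N'Z: "N' \<in> Zplus GL2Z N a"
      using N'c \<alpha>(1) by (auto simp: Zplus_def intro!: exI[of _ "\<alpha> - 1"])
    have mul: "A \<otimes>\<^bsub>GL2Z\<^esub> B = A ** B" for A B by (simp add: GL2Z_def)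
    have N_pow: "N [^]\<^bsub>GL2Z\<^esub> k = N' [^]\<^bsub>GL2Z\<^esub> (2 * k)" for k :: int
    proof -
      have "N = N' [^]\<^bsub>GL2Z\<^esub> (2::int)"
        using int_pow_mult[OF N'c, of 1 1] N'c sq mul by simp
      then show ?thesis using int_pow_pow[OF N'c] by metis
    qed
    have "\<exists>k :: int. K = N' [^]\<^bsub>GL2Z\<^esub> k" if K: "K \<in> Zplus GL2Z N a" for K
    proof (cases "det K = 1")
      case True
      then show ?thesis using cases[OF K] N_pow by auto
    next
      case False
      have Kc: "K \<in> carrier GL2Z" using K by (simp add: Zplus_def)
      \<comment> \<open>One factor \<open>N'\<close> changes determinant -1 to 1, so the product is
        a power of \<open>N\<close>, an even power of \<open>N'\<close>; hence \<open>K\<close> is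
        an odd power.\<close>
      have "K \<otimes>\<^bsub>GL2Z\<^esub> N' \<in> Zplus GL2Z N a"
        using subgroup.m_closed[OF subgroup_Zplus_GL2Z K N'Z] .
      moreover have "det (K \<otimes>\<^bsub>GL2Z\<^esub> N') = 1"
        using False cases[OF K] det' by (auto simp: GL2Z_def det_mul)
      ultimately obtain k :: int where k: "K \<otimes>\<^bsub>GL2Z\<^esub> N' = N' [^]\<^bsub>GL2Z\<^esub> (2 * k)"
        using cases N_pow by fastforce
      have "K = K \<otimes>\<^bsub>GL2Z\<^esub> N' \<otimes>\<^bsub>GL2Z\<^esub> inv\<^bsub>GL2Z\<^esub> N'" using Kc N'c by (simp add: m_assoc)
      also have "\<dots> = N' [^]\<^bsub>GL2Z\<^esub> (2 * k - 1)" using N'c k by (simp add: int_pow_diff)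
      finally show ?thesis by blast
    qed
    then have "Zplus GL2Z N a = generate GL2Z {N'}"
      using subgroup_int_pow_closed[OF subgroup_Zplus_GL2Z N'Z] generate_pow[OF N'c] by auto
    then show ?thesis using N'c sq det' by blast
  qed
  show ?thesis using powers sub gen part2 part3 by blast
qed

end
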